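(* Let $F>0$, let $N\ge 1$ be an integer and $\epsilon=1/N$. Suppose that $$\phi''_{F}>0,\ \phi''_{2F}<0,\quad \rho'_{F}\le 0,\ \rho'_{2F}\le 0,\quad \rho''_{F}\ge 0,\ \rho''_{2F}\ge 0,\quad G''_{F}\ge 0,$$ and that $B_F\ge 0$. Then the uniform deformation $\mathbf{y}_F$ is stable for the atomistic model, i.e. $\langle\delta^2\mathcal{E}^a(\mathbf{y}_F)\mathbf{u},\mathbf{u}\rangle>0$ for all $\mathbf{u}\in\mathcal{U}\setminus\{\mathbf{0}\}$, if and only if $$\lambda^a_F(s_1)=A_F+B_F\left[4\sin^2\left(\tfrac{\pi}{2N}\right)\right]+C_F\left[4\sin^2\left(\tfrac{\pi}{2N}\right)\right]^2+D_F\left[4\sin^2\left(\tfrac{\pi}{2N}\right)\right]^3>0 .$$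
   Context: Fix smooth functions $\phi,\rho:(0,\infty)\to\mathbb{R}$ (pair potential, electron density) and $G:\mathbb{R}\to\mathbb{R}$ (embedding function), $F>0$, an integer $N\ge1$, and $\epsilon=1/N$. Let $\mathcal{U}$ be the space of real sequences $\mathbf{u}=(u_\ell)_{\ell\in\mathbb{Z}}$ with $u_{\ell+2N}=u_\ell$ and $\sum_{\ell=-N+1}^N u_\ell=0$. Let $(\mathbf{y}_F)_\ell=F\epsilon\ell$ and $\mathcal{Y}_F=\{\mathbf{y}_F+\mathbf{u}:\mathbf{u}\in\mathcal{U}\}$. For a sequence $\mathbf{y}$ put $y'_\ell=(y_\ell-y_{\ell-1})/\epsilon$. Atomistic (next-nearest neighbour EAM) energy: for $\mathbf{y}\in\mathcal{Y}_F$ (near $\mathbf{y}_F$), $$\mathcal{E}^a(\mathbf{y})=\epsilon\sum_{\ell=-N+1}^N\Big\{G\big(\bar\rho^a_\ell(\mathbf{y})\big)+\tfrac12\big[\phi(y'_\ell)+\phi(y'_\ell+y'_{\ell-1})+\phi(y'_{\ell+1})+\phi(y'_{\ell+1}+y'_{\ell+2})\big]\Big\},$$ $$\bar\rho^a_\ell(\mathbf{y})=\rho(y'_\ell)+\rho(y'_\ell+y'_{\ell-1})+\rho(y'_{\ell+1})+\rho(y'_{\ell+1}+y'_{\ell+2}).$$ The second variation is the quadratic form $\langle\delta^2\mathcal{E}^a(\mathbf{y}_F)\mathbf{u},\mathbf{u}\rangle=\frac{d^2}{dt^2}\mathcal{E}^a(\mathbf{y}_F+t\mathbf{u})\big|_{t=0}$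 for $\mathbf{u}\in\mathcal{U}$. Notation: $\phi''_F=\phi''(F)$, $\phi''_{2F}=\phi''(2F)$, $\rho'_F=\rho'(F)$, $\rho'_{2F}=\rho'(2F)$, $\rho''_F=\rho''(F)$, $\rho''_{2F}=\rho''(2F)$, and $G'_F=G'(\bar\rho_F)$, $G''_F=G''(\bar\rho_F)$ with $\bar\rho_F=2\rho(F)+2\rho(2F)$. Put $$A_F=4G''_F(\rho'_F+2\rho'_{2F})^2+2G'_F(\rho''_F+4\rho''_{2F})+\phi''_F+4\phi''_{2F},$$ $$B_F=-\big[\phi''_{2F}+G''_F\big((\rho'_F)^2+20(\rho'_{2F})^2+12\rho'_F\rho'_{2F}\big)+2G'_F\rho''_{2F}\big],$$ $$C_F=G''_F\big(8(\rho'_{2F})^2+2\rho'_F\rho'_{2F}\big),\qquad D_F=-G''_F(\rho'_{2F})^2,$$ $\lambda^a_F(s)=A_F+B_Fs+C_Fs^2+D_Fs^3$, and $s_1=4\sin^2(\pi/(2N))$. *)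

theory Defs
  imports "HOL-Analysis.Analysis"
begin

text \<open>
  Sequences indexed by the integers are functions \<open>int \<Rightarrow> real\<close>. The pair potential \<open>\<phi>\<close> and the
  electron density \<open>\<rho>\<close> live on \<open>{0<..}\<close> only; they are total functions here, whose values on
  \<open>{..0}\<close> are arbitrary and never enter the second variation at a uniform deformation with \<open>F > 0\<close>.
\<close>

text \<open>Intended for open \<open>S\<close>, where the two-sided derivatives below are determined by \<open>f\<close> on \<open>S\<close>.\<close>

definition smooth_on :: "real set \<Rightarrow> (real \<Rightarrow> real) \<Rightarrow> bool" where
  "smooth_on S f \<longleftrightarrow> (\<forall>n. ((deriv ^^ n) f) differentiable_on S)"

definition lattice_eps :: "nat \<Rightarrow> real" where
  "lattice_eps N = 1 / real N"

definition displacements :: "nat \<Rightarrow> (int \<Rightarrow> real) set" where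
  "displacements N =
     {u. (\<forall>l. u (l + 2 * int N) = u l) \<and> (\<Sum>l = - int N + 1..int N. u l) = 0}"

definition uniform_deformation :: "real \<Rightarrow> nat \<Rightarrow> int \<Rightarrow> real" where
  "uniform_deformation F N l = F * lattice_eps N * real_of_int l"

definition bdiff :: "nat \<Rightarrow> (int \<Rightarrow> real) \<Rightarrow> int \<Rightarrow> real" where
  "bdiff N y l = (y l - y (l - 1)) / lattice_eps N"

definition rho_bar :: "(real \<Rightarrow> real) \<Rightarrow> nat \<Rightarrow> (int \<Rightarrow> real) \<Rightarrow> int \<Rightarrow> real" where
  "rho_bar \<rho> N y l =
     \<rho> (bdiff N y l) + \<rho> (bdiff N y l + bdiff N y (l - 1))
     + \<rho> (bdiff N y (l + 1)) + \<rho> (bdiff N y (l + 1) + bdiff N y (l + 2))"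

definition energy_a ::
  "(real \<Rightarrow> real) \<Rightarrow> (real \<Rightarrow> real) \<Rightarrow> (real \<Rightarrow> real) \<Rightarrow> nat \<Rightarrow> (int \<Rightarrow> real) \<Rightarrow> real" where
  "energy_a \<phi> \<rho> G N y =
     lattice_eps N * (\<Sum>l = - int N + 1..int N.
       G (rho_bar \<rho> N y l)
       + 1 / 2 * (\<phi> (bdiff N y l) + \<phi> (bdiff N y l + bdiff N y (l - 1))
                  + \<phi> (bdiff N y (l + 1)) + \<phi> (bdiff N y (l + 1) + bdiff N y (l + 2))))"

definition second_variation ::
  "((int \<Rightarrow> real) \<Rightarrow> real) \<Rightarrow> (int \<Rightarrow> real) \<Rightarrow> (int \<Rightarrow> real) \<Rightarrow> real" where
  "second_variation E y u = (deriv ^^ 2) (\<lambda>t::real. E (\<lambda>l. y l + t * u l)) 0"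

definition stable_a ::
  "(real \<Rightarrow> real) \<Rightarrow> (real \<Rightarrow> real) \<Rightarrow> (real \<Rightarrow> real) \<Rightarrow> real \<Rightarrow> nat \<Rightarrow> bool" where
  "stable_a \<phi> \<rho> G F N \<longleftrightarrow>
     (\<forall>u \<in> displacements N - {\<lambda>_. 0}.
        second_variation (energy_a \<phi> \<rho> G N) (uniform_deformation F N) u > 0)"

definition rho_bar_F :: "(real \<Rightarrow> real) \<Rightarrow> real \<Rightarrow> real" where
  "rho_bar_F \<rho> F = 2 * \<rho> F + 2 * \<rho> (2 * F)"

definition coeff_A :: "(real \<Rightarrow> real) \<Rightarrow> (real \<Rightarrow> real) \<Rightarrow> (real \<Rightarrow> real) \<Rightarrow> real \<Rightarrow> real" where
  "coeff_A \<phi> \<rho> G F =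
     4 * (deriv ^^ 2) G (rho_bar_F \<rho> F) * (deriv \<rho> F + 2 * deriv \<rho> (2 * F))^2
     + 2 * deriv G (rho_bar_F \<rho> F) * ((deriv ^^ 2) \<rho> F + 4 * (deriv ^^ 2) \<rho> (2 * F))
     + (deriv ^^ 2) \<phi> F + 4 * (deriv ^^ 2) \<phi> (2 * F)"

definition coeff_B :: "(real \<Rightarrow> real) \<Rightarrow> (real \<Rightarrow> real) \<Rightarrow> (real \<Rightarrow> real) \<Rightarrow> real \<Rightarrow> real" where
  "coeff_B \<phi> \<rho> G F =
     - ((deriv ^^ 2) \<phi> (2 * F)
        + (deriv ^^ 2) G (rho_bar_F \<rho> F)
          * ((deriv \<rho> F)^2 + 20 * (deriv \<rho> (2 * F))^2 + 12 * deriv \<rho> F * deriv \<rho> (2 * F))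
        + 2 * deriv G (rho_bar_F \<rho> F) * (deriv ^^ 2) \<rho> (2 * F))"

definition coeff_C :: "(real \<Rightarrow> real) \<Rightarrow> (real \<Rightarrow> real) \<Rightarrow> real \<Rightarrow> real" where
  "coeff_C \<rho> G F =
     (deriv ^^ 2) G (rho_bar_F \<rho> F)
     * (8 * (deriv \<rho> (2 * F))^2 + 2 * deriv \<rho> F * deriv \<rho> (2 * F))"

definition coeff_D :: "(real \<Rightarrow> real) \<Rightarrow> (real \<Rightarrow> real) \<Rightarrow> real \<Rightarrow> real" where
  "coeff_D \<rho> G F = - ((deriv ^^ 2) G (rho_bar_F \<rho> F) * (deriv \<rho> (2 * F))^2)"

definition lambda_a ::
  "(real \<Rightarrow> real) \<Rightarrow> (real \<Rightarrow> real) \<Rightarrow> (real \<Rightarrow> real) \<Rightarrow> real \<Rightarrow> real \<Rightarrow> real" where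
  "lambda_a \<phi> \<rho> G F s =
     coeff_A \<phi> \<rho> G F + coeff_B \<phi> \<rho> G F * s + coeff_C \<rho> G F * s^2 + coeff_D \<rho> G F * s^3"

end

theory Submission
  imports Defs
begin

text \<open>
  The second variation at \<open>y\<^sub>F\<close> is a translation-invariant quadratic form in the strain
  \<open>w\<^sub>l = u'\<^sub>l\<close>, hence a linear combination of the autocorrelations \<open>\<Sum>\<^sub>l w\<^sub>l w\<^sub>l\<^sub>+\<^sub>j\<close> with
  \<open>j \<le> 3\<close>. By the discrete Wiener--Khinchin identity these are the cosine moments of the power
  spectrum of \<open>w\<close>, which has no mass at frequency 0, so the form is the average of
  \<open>\<lambda>(4 sin\<^sup>2(\<pi>m/(2N)))\<close> over \<open>0 < m < 2N\<close> against the power spectrum. The sign hypotheses make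
  \<open>\<lambda>\<close> nondecreasing on \<open>[0, 4]\<close>, so its least value is attained at \<open>m = 1\<close>. Conversely,
  testing with \<open>u\<^sub>l = cos(\<pi>l/N)\<close> gives a nonnegative multiple of \<open>\<lambda>(s\<^sub>1)\<close>.
\<close>

section \<open>Second-order derivatives at a point\<close>

text \<open>\<open>deriv\<close> returns some value even where no derivative exists, so an equation
  about it does not compose. This relation carries existence together with both values
  \<open>d\<close> and \<open>e\<close>, and only local information: differentiability near
  \<open>x\<close>, as the potentials are smooth on the positive reals only.\<close>

definition twice_deriv :: "(real \<Rightarrow> real) \<Rightarrow> real \<Rightarrow> real \<Rightarrow> real \<Rightarrow> bool" where
  "twice_deriv f x d e \<longleftrightarrow>
     (\<exists>f'. (\<forall>\<^sub>F t in nhds x. (f has_real_derivative f' t) (at t)) \<and> f' x = d \<and>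
           (f' has_real_derivative e) (at x))"

text \<open>\<open>deriv f\<close> agrees with the witness \<open>f'\<close> near \<open>x\<close>,
  and a derivative at \<open>x\<close> depends only on values near \<open>x\<close>.\<close>

lemma twice_deriv_imp_deriv2:
  assumes "twice_deriv f x d e"
  shows "(deriv ^^ 2) f x = e"
proof -
  obtain f' where f': "\<forall>\<^sub>F t in nhds x. (f has_real_derivative f' t) (at t)"
    and e: "(f' has_real_derivative e) (at x)"
    using assms unfolding twice_deriv_def by blast
  have "\<forall>\<^sub>F t in nhds x. deriv f t = f' t"
    using f' by eventually_elim (rule DERIV_imp_deriv)
  then have "deriv (deriv f) x = deriv f' x"
    by (rule deriv_cong_ev) simp
  also have "\<dots> = e"
    using e by (rule DERIV_imp_deriv)
  finally show ?thesis
    by (simp add: numeral_2_eq_2)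
qed

lemma twice_deriv_affine: "twice_deriv (\<lambda>t. c + t * d) x d 0"
  unfolding twice_deriv_def
  by (rule exI[of _ "\<lambda>_. d"]) (auto intro!: derivative_eq_intros always_eventually)

lemma twice_deriv_add:
  assumes "twice_deriv f x d e" "twice_deriv g x d' e'"
  shows "twice_deriv (\<lambda>t. f t + g t) x (d + d') (e + e')"
proof -
  obtain f' g' where
    "\<forall>\<^sub>F t in nhds x. (f has_real_derivative f' t) (at t)" "f' x = d"
    "(f' has_real_derivative e) (at x)"
    "\<forall>\<^sub>F t in nhds x. (g has_real_derivative g' t) (at t)" "g' x = d'"
    "(g' has_real_derivative e') (at x)"
    using assms unfolding twice_deriv_def by blast
  then show ?thesis
    unfolding twice_deriv_def
    by (intro exI[of _ "\<lambda>t. f' t + g' t"])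
       (auto intro!: DERIV_add elim: eventually_elim2)
qed

lemma twice_deriv_cmult:
  assumes "twice_deriv f x d e"
  shows "twice_deriv (\<lambda>t. c * f t) x (c * d) (c * e)"
proof -
  obtain f' where
    "\<forall>\<^sub>F t in nhds x. (f has_real_derivative f' t) (at t)" "f' x = d"
    "(f' has_real_derivative e) (at x)"
    using assms unfolding twice_deriv_def by blast
  then show ?thesis
    unfolding twice_deriv_def
    by (intro exI[of _ "\<lambda>t. c * f' t"]) (auto intro!: DERIV_cmult elim: eventually_mono)
qed

lemma twice_deriv_sum:
  assumes "finite A" "\<And>i. i \<in> A \<Longrightarrow> twice_deriv (f i) x (d i) (e i)"
  shows "twice_deriv (\<lambda>t. \<Sum>i\<in>A. f i t) x (\<Sum>i\<in>A. d i) (\<Sum>i\<in>A. e i)"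
  using assms
proof (induction A rule: finite_induct)
  case empty
  then show ?case using twice_deriv_affine[of 0 0] by simp
next
  case (insert i A)
  then show ?case by (simp add: twice_deriv_add)
qed

text \<open>Continuity of \<open>g\<close> at \<open>x\<close> pulls the neighbourhood of
  \<open>g x\<close> on which \<open>h\<close> is differentiable back to a neighbourhood of
  \<open>x\<close>. There the chain rule gives the first derivative, and the product rule
  differentiates it once more at \<open>x\<close>.\<close>

lemma twice_deriv_compose:
  assumes h: "twice_deriv h (g x) d' e'" and g: "twice_deriv g x d e"
  shows "twice_deriv (\<lambda>t. h (g t)) x (d' * d) (e' * d\<^sup>2 + d' * e)"
proof -
  obtain g' where g': "\<forall>\<^sub>F t in nhds x. (g has_real_derivative g' t) (at t)" "g' x = d"
    "(g' has_real_derivative e) (at x)"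
    using g unfolding twice_deriv_def by blast
  obtain h' where h': "\<forall>\<^sub>F t in nhds (g x). (h has_real_derivative h' t) (at t)" "h' (g x) = d'"
    "(h' has_real_derivative e') (at (g x))"
    using h unfolding twice_deriv_def by blast
  have gx: "(g has_real_derivative d) (at x)"
    using eventually_nhds_x_imp_x[OF g'(1)] g'(2) by simp
  have "isCont g x"
    using gx by (rule DERIV_isCont)
  then have "filterlim g (nhds (g x)) (nhds x)"
    unfolding continuous_at tendsto_at_iff_tendsto_nhds .
  with h'(1) have "\<forall>\<^sub>F t in nhds x. (h has_real_derivative h' (g t)) (at (g t))"
    by (rule eventually_compose_filterlim)
  with g'(1) have "\<forall>\<^sub>F t in nhds x. ((\<lambda>t. h (g t)) has_real_derivative h' (g t) * g' t) (at t)"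
    by eventually_elim (rule DERIV_chain2)
  moreover have "((\<lambda>t. h' (g t) * g' t) has_real_derivative e' * d\<^sup>2 + d' * e) (at x)"
    using DERIV_mult[OF DERIV_chain2[OF h'(3) gx] g'(3)] g'(2) h'(2)
    by (simp add: power2_eq_square algebra_simps)
  ultimately show ?thesis
    using g'(2) h'(2) unfolding twice_deriv_def
    by (intro exI[of _ "\<lambda>t. h' (g t) * g' t"]) simp
qed

lemma smooth_on_twice_deriv:
  assumes "smooth_on S f" "open S" "x \<in> S"
  shows "twice_deriv f x (deriv f x) ((deriv ^^ 2) f x)"
proof -
  have D: "(((deriv ^^ n) f) has_real_derivative deriv ((deriv ^^ n) f) t) (at t)"
    if "t \<in> S" for n t
    using assms(1,2) that unfolding smooth_on_def
    by (metis DERIV_deriv_iff_real_differentiable differentiable_on_eq_differentiable_at)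
  have "\<forall>\<^sub>F t in nhds x. t \<in> S"
    using assms(2,3) by (rule eventually_nhds_in_open)
  then have "\<forall>\<^sub>F t in nhds x. (f has_real_derivative deriv f t) (at t)"
    by eventually_elim (use D[of _ 0] in simp)
  moreover have "(deriv f has_real_derivative (deriv ^^ 2) f x) (at x)"
    using D[of x 1] assms(3) by (simp add: numeral_2_eq_2)
  ultimately show ?thesis
    unfolding twice_deriv_def by blast
qed

section \<open>Periodic sequences and their power spectrum\<close>

text \<open>Moving the window by one trades \<open>g c\<close> for the equal value
  \<open>g (c + int n)\<close>; induction on the shift, in both directions, does the rest.\<close>

lemma sum_period_shift:
  fixes g :: "int \<Rightarrow> real"
  assumes "\<And>l. g (l + int n) = g l"
  shows "sum g {b..<b + int n} = sum g {a..<a + int n}"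
proof -
  have step: "sum g {c + 1..<c + 1 + int n} = sum g {c..<c + int n}" for c
  proof (cases "n = 0")
    case False
    then have "{c..<c + int n} = insert c {c + 1..<c + int n}"
      and "{c + 1..<c + 1 + int n} = insert (c + int n) {c + 1..<c + int n}"
      by auto
    then show ?thesis using assms[of c] by simp
  qed simp
  have "sum g {a + k..<a + k + int n} = sum g {a..<a + int n}" for k
  proof (induction k rule: int_induct[where k = 0])
    case (step1 i)
    then show ?case using step[of "a + i"] by (simp add: add.assoc)
  next
    case (step2 i)
    then show ?case using step[of "a + (i - 1)"] by (simp add: algebra_simps)
  qed simp
  from this[of "b - a"] show ?thesis by simp
qed

lemma sum_period_translate:
  fixes g :: "int \<Rightarrow> real"
  assumes "\<And>l. g (l + int n) = g l"
  shows "(\<Sum>l\<in>{a..<a + int n}. g (l + k)) = sum g {a..<a + int n}"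
proof -
  have "(\<Sum>l\<in>{a..<a + int n}. g (l + k)) = sum g {a + k..<a + k + int n}"
    by (rule sum.reindex_bij_witness[of _ "\<lambda>l. l - k" "\<lambda>l. l + k"]) auto
  also have "\<dots> = sum g {a..<a + int n}"
    by (rule sum_period_shift) (rule assms)
  finally show ?thesis .
qed

text \<open>In the window moved to start at \<open>i\<close>, the index \<open>i\<close> is the only
  one congruent to \<open>i\<close> modulo \<open>n\<close>.\<close>

lemma sum_period_residue:
  fixes w :: "int \<Rightarrow> real"
  assumes per: "\<And>l. w (l + int n) = w l" and "n > 0"
  shows "(\<Sum>k\<in>{a..<a + int n}. w k * of_bool (int n dvd k - i)) = w i"
proof -
  let ?g = "\<lambda>k. w k * of_bool (int n dvd k - i)"
  have "int n dvd k + int n - i \<longleftrightarrow> int n dvd k - i" for k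
    by (metis dvd_add_triv_right_iff diff_add_eq)
  then have "sum ?g {a..<a + int n} = sum ?g {i..<i + int n}"
    by (intro sum_period_shift) (simp add: per)
  also have "\<dots> = sum ?g {i}"
  proof (rule sum.mono_neutral_right)
    show "\<forall>k\<in>{i..<i + int n} - {i}. ?g k = 0"
      using zdvd_not_zless[of _ "int n"] by auto
  qed (use \<open>n > 0\<close> in auto)
  finally show ?thesis by simp
qed

text \<open>Real part of a geometric sum over powers of an \<open>n\<close>-th root of unity
  \<open>z\<close>: it equals \<open>n\<close> if \<open>z = 1\<close> and vanishes
  otherwise.\<close>

lemma sum_cos_roots_of_unity:
  assumes "n > 0"
  shows "(\<Sum>m<n. cos (2 * pi * real m * of_int d / real n)) = real n * of_bool (int n dvd d)"
proof -
  define z where "z = cis (2 * pi * of_int d / real n)"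
  have zm: "Re (z ^ m) = cos (2 * pi * real m * of_int d / real n)" for m
    unfolding z_def Complex.DeMoivre by (simp add: mult.commute mult.left_commute)
  have "z ^ n = cis (2 * pi * of_int d)"
    using assms unfolding z_def Complex.DeMoivre by simp
  then have zn: "z ^ n = 1"
    by simp
  have z1: "z = 1 \<longleftrightarrow> int n dvd d"
  proof
    assume "z = 1"
    then have "cos (2 * pi * of_int d / real n) = 1"
      using zm[of 1] by simp
    then obtain k :: int where "2 * pi * of_int d / real n = of_int k * 2 * pi"
      unfolding cos_one_2pi_int by blast
    then have "real_of_int d = of_int (k * int n)"
      using assms by (simp add: field_simps)
    then show "int n dvd d"
      by (simp only: of_int_eq_iff) simp
  next
    assume "int n dvd d"
    then obtain k where "d = int n * k" ..
    then have "2 * pi * of_int d / real n = 2 * pi * of_int k"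
      using assms by simp
    then show "z = 1"
      unfolding z_def by simp
  qed
  have "(\<Sum>m<n. z ^ m) = of_nat n * of_bool (int n dvd d)"
    using sum_gp_strict[of z n] zn z1 by simp
  then have "Re (\<Sum>m<n. z ^ m) = real n * of_bool (int n dvd d)"
    by simp
  then show ?thesis
    by (simp add: zm)
qed

text \<open>Squared modulus of the unnormalised discrete Fourier transform over one period, split
  into real and imaginary parts to stay within the reals.\<close>

definition power_spectrum :: "nat \<Rightarrow> int \<Rightarrow> (int \<Rightarrow> real) \<Rightarrow> nat \<Rightarrow> real" where
  "power_spectrum n a w m =
     (\<Sum>l\<in>{a..<a + int n}. w l * cos (2 * pi * real m * of_int l / real n))\<^sup>2 +
     (\<Sum>l\<in>{a..<a + int n}. w l * sin (2 * pi * real m * of_int l / real n))\<^sup>2"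

section \<open>Autocorrelations and the discrete Wiener--Khinchin identity\<close>

definition autocorrelation :: "nat \<Rightarrow> int \<Rightarrow> (int \<Rightarrow> real) \<Rightarrow> int \<Rightarrow> real" where
  "autocorrelation n a w j = (\<Sum>l\<in>{a..<a + int n}. w l * w (l + j))"

lemma sum_shifted_products:
  assumes "\<And>l. w (l + int n) = w l"
  shows "(\<Sum>l\<in>{a..<a + int n}. w (l + i) * w (l + j)) = autocorrelation n a w (j - i)"
proof -
  have per: "w (l + int n + (j - i)) = w (l + (j - i))" for l
    using assms[of "l + (j - i)"] by (simp add: algebra_simps)
  show ?thesis
    using sum_period_translate[of "\<lambda>l. w l * w (l + (j - i))" n i a] per assms
    by (simp add: autocorrelation_def)
qed

lemma autocorrelation_minus:
  assumes "\<And>l. w (l + int n) = w l"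
  shows "autocorrelation n a w (- j) = autocorrelation n a w j"
  using sum_shifted_products[where w = w and n = n and a = a and i = j and j = 0, OF assms]
  by (simp add: autocorrelation_def mult.commute)

text \<open>Expanding the squares turns the spectrum into a double sum of \<open>w l * w k\<close>
  against the cosine at lag \<open>k - l\<close>. After summation over \<open>m\<close>,
  orthogonality keeps only the pairs with \<open>k\<close> congruent to \<open>l + j\<close> or
  \<open>l - j\<close>, each with weight \<open>n / 2\<close>; evenness of the autocorrelation
  merges the two.\<close>

lemma autocorrelation_power_spectrum:
  assumes per: "\<And>l. w (l + int n) = w l" and "n > 0"
  shows "(\<Sum>m<n. cos (2 * pi * real m * of_int j / real n) * power_spectrum n a w m)
         = real n * autocorrelation n a w j"
proof -
  let ?I = "{a..<a + int n}"
  let ?c = "\<lambda>m (d::int). cos (2 * pi * real m * of_int d / real n)"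
  have spec: "power_spectrum n a w m = (\<Sum>l\<in>?I. \<Sum>k\<in>?I. w l * w k * ?c m (k - l))" for m
    unfolding power_spectrum_def power2_eq_square sum_product sum.distrib[symmetric]
    by (intro sum.cong refl)
       (simp add: right_diff_distrib diff_divide_distrib cos_diff algebra_simps)
  have prod: "?c m j * ?c m d = (?c m (d - j) + ?c m (d + j)) / 2" for m d
    by (simp add: cos_times_cos algebra_simps diff_divide_distrib add_divide_distrib)
  have orth: "(\<Sum>m<n. ?c m j * ?c m d) =
      real n / 2 * (of_bool (int n dvd d - j) + of_bool (int n dvd d + j))" for d
    unfolding prod sum_divide_distrib[symmetric] sum.distrib
      sum_cos_roots_of_unity[OF \<open>n > 0\<close>] by (simp add: algebra_simps)
  have "(\<Sum>m<n. ?c m j * power_spectrum n a w m) =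
        (\<Sum>m<n. \<Sum>l\<in>?I. \<Sum>k\<in>?I. w l * w k * (?c m j * ?c m (k - l)))"
    unfolding spec sum_distrib_left by (intro sum.cong refl) (simp add: mult_ac)
  also have "\<dots> = (\<Sum>l\<in>?I. \<Sum>k\<in>?I. w l * w k * (\<Sum>m<n. ?c m j * ?c m (k - l)))"
    unfolding sum_distrib_left
    by (subst sum.swap, intro sum.cong refl, rule sum.swap)
  also have "\<dots> = (\<Sum>l\<in>?I. real n / 2 * w l *
      ((\<Sum>k\<in>?I. w k * of_bool (int n dvd k - (l + j))) +
       (\<Sum>k\<in>?I. w k * of_bool (int n dvd k - (l + - j)))))"
    unfolding orth sum.distrib[symmetric] sum_distrib_left
    by (intro sum.cong refl) (simp add: algebra_simps)
  also have "\<dots> = (\<Sum>l\<in>?I. real n / 2 * (w l * w (l + j)) + real n / 2 * (w l * w (l + - j)))"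
    unfolding sum_period_residue[where w = w, OF per \<open>n > 0\<close>]
    by (simp add: algebra_simps add_divide_distrib)
  also have "\<dots> = real n / 2 * (autocorrelation n a w j + autocorrelation n a w (- j))"
    by (simp only: sum.distrib sum_distrib_left[symmetric] autocorrelation_def distrib_left)
  finally show ?thesis
    by (simp add: autocorrelation_minus[where w = w, OF per])
qed

section \<open>The quadratic form\<close>

text \<open>
  Here \<open>c\<^sub>j\<close> stands for the autocorrelation of \<open>w\<close> at lag \<open>j\<close>; the embedding part is the
  sum of the squares of \<open>(a + b) (w\<^sub>l + w\<^sub>l\<^sub>+\<^sub>1) + b (w\<^sub>l\<^sub>-\<^sub>1 + w\<^sub>l\<^sub>+\<^sub>2)\<close>, the derivative of the density.
\<close>

definition eam_form ::
  "(real \<Rightarrow> real) \<Rightarrow> (real \<Rightarrow> real) \<Rightarrow> (real \<Rightarrow> real) \<Rightarrow> real \<Rightarrow> real \<Rightarrow> real \<Rightarrow> real \<Rightarrow> real \<Rightarrow> real"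
  where
  "eam_form \<phi> \<rho> G F c0 c1 c2 c3 =
     (let a = deriv \<rho> F; b = deriv \<rho> (2 * F) in
      (deriv ^^ 2) G (rho_bar_F \<rho> F) *
        ((a + b)\<^sup>2 * (2 * c0 + 2 * c1) + 4 * (a + b) * b * (c1 + c2) + b\<^sup>2 * (2 * c0 + 2 * c3))
      + deriv G (rho_bar_F \<rho> F) *
        ((deriv ^^ 2) \<rho> F * (2 * c0) + (deriv ^^ 2) \<rho> (2 * F) * (4 * c0 + 4 * c1))
      + (deriv ^^ 2) \<phi> F * c0 + (deriv ^^ 2) \<phi> (2 * F) * (2 * c0 + 2 * c1))"

text \<open>Linearity in the four correlations, here and in the next lemma, lets the form be
  evaluated frequency by frequency.\<close>

lemma eam_form_sum:
  "(\<Sum>m\<in>A. eam_form \<phi> \<rho> G F (c0 m) (c1 m) (c2 m) (c3 m)) =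
   eam_form \<phi> \<rho> G F (\<Sum>m\<in>A. c0 m) (\<Sum>m\<in>A. c1 m) (\<Sum>m\<in>A. c2 m) (\<Sum>m\<in>A. c3 m)"
  by (simp add: eam_form_def Let_def sum.distrib flip: sum_distrib_left)

lemma eam_form_mult:
  "eam_form \<phi> \<rho> G F (r * c0) (r * c1) (r * c2) (r * c3) = r * eam_form \<phi> \<rho> G F c0 c1 c2 c3"
  by (simp add: eam_form_def Let_def algebra_simps)

text \<open>A pure mode of phase \<theta> has correlations proportional to
  \<open>cos (j * \<theta>)\<close>. With \<open>x = cos \<theta>\<close> the arguments are the
  Chebyshev polynomials of degrees 0 to 3, and \<open>2 - 2 * x\<close> is
  \<open>4 * (sin (\<theta> / 2))\<^sup>2\<close>.\<close>

lemma eam_form_symbol: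
  "eam_form \<phi> \<rho> G F 1 x (2 * x\<^sup>2 - 1) (4 * x ^ 3 - 3 * x) = lambda_a \<phi> \<rho> G F (2 - 2 * x)"
  unfolding eam_form_def Let_def lambda_a_def coeff_A_def coeff_B_def coeff_C_def coeff_D_def
  by algebra

section \<open>Second variation as a quadratic form in the strain\<close>

lemma bdiff_periodic:
  assumes "u \<in> displacements N"
  shows "bdiff N u (l + int (2 * N)) = bdiff N u l"
proof -
  have "u (l + 2 * int N) = u l" "u (l - 1 + 2 * int N) = u (l - 1)"
    using assms unfolding displacements_def by blast+
  then show ?thesis
    by (simp add: bdiff_def algebra_simps)
qed

text \<open>Along \<open>y_F + t u\<close> every strain is affine in \<open>t\<close>, so the chain
  rule differentiates each summand. Summed over a period, a product of two shifted strains depends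
  only on their lag.\<close>

lemma second_variation_energy_a:
  fixes \<phi> \<rho> G :: "real \<Rightarrow> real"
  assumes \<phi>: "smooth_on {0<..} \<phi>" and \<rho>: "smooth_on {0<..} \<rho>" and G: "smooth_on UNIV G"
    and "F > 0" "N \<ge> 1" and u: "u \<in> displacements N"
  defines "c \<equiv> autocorrelation (2 * N) (1 - int N) (bdiff N u)"
  shows "second_variation (energy_a \<phi> \<rho> G N) (uniform_deformation F N) u =
         lattice_eps N * eam_form \<phi> \<rho> G F (c 0) (c 1) (c 2) (c 3)"
proof -
  define w where "w = bdiff N u"
  let ?y = "\<lambda>t l. uniform_deformation F N l + t * u l"
  let ?r = "rho_bar_F \<rho> F"
  have strain: "bdiff N (?y t) l = F + t * w l" for t l
    using \<open>N \<ge> 1\<close>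
    by (simp add: bdiff_def uniform_deformation_def lattice_eps_def w_def field_simps)
  have pair: "twice_deriv (\<lambda>t. f (bdiff N (?y t) l)) 0 (deriv f F * w l) ((deriv ^^ 2) f F * (w l)\<^sup>2)"
    "twice_deriv (\<lambda>t. f (bdiff N (?y t) l + bdiff N (?y t) k)) 0 (deriv f (2 * F) * (w l + w k))
       ((deriv ^^ 2) f (2 * F) * (w l + w k)\<^sup>2)"
    if f: "smooth_on {0<..} f" for f l k
  proof -
    show "twice_deriv (\<lambda>t. f (bdiff N (?y t) l)) 0 (deriv f F * w l) ((deriv ^^ 2) f F * (w l)\<^sup>2)"
      using twice_deriv_compose[OF _ twice_deriv_affine, of f F 0 "w l"]
        smooth_on_twice_deriv[OF f, of F] \<open>F > 0\<close> by (simp add: strain)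
    have "bdiff N (?y t) l + bdiff N (?y t) k = 2 * F + t * (w l + w k)" for t
      by (simp add: strain algebra_simps)
    then show "twice_deriv (\<lambda>t. f (bdiff N (?y t) l + bdiff N (?y t) k)) 0
        (deriv f (2 * F) * (w l + w k)) ((deriv ^^ 2) f (2 * F) * (w l + w k)\<^sup>2)"
      using twice_deriv_compose[OF _ twice_deriv_affine, of f "2 * F" 0 "w l + w k"]
        smooth_on_twice_deriv[OF f, of "2 * F"] \<open>F > 0\<close> by simp
  qed
  \<comment> \<open>\<open>d l\<close> and \<open>e \<rho> l\<close> are the first and second
    derivatives of the density at site \<open>l\<close>. Since the pair energy has the same four
    arguments, \<open>e\<close> takes the function as a parameter.\<close>
  define d where "d l = deriv \<rho> F * w l + deriv \<rho> (2 * F) * (w l + w (l - 1))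
      + deriv \<rho> F * w (l + 1) + deriv \<rho> (2 * F) * (w (l + 1) + w (l + 2))" for l
  define e where "e f l = (deriv ^^ 2) f F * (w l)\<^sup>2 + (deriv ^^ 2) f (2 * F) * (w l + w (l - 1))\<^sup>2
      + (deriv ^^ 2) f F * (w (l + 1))\<^sup>2 + (deriv ^^ 2) f (2 * F) * (w (l + 1) + w (l + 2))\<^sup>2"
    for f l
  have rho: "twice_deriv (\<lambda>t. rho_bar \<rho> N (?y t) l) 0 (d l) (e \<rho> l)" for l
    unfolding rho_bar_def d_def e_def by (intro twice_deriv_add pair \<rho>)
  have r0: "rho_bar \<rho> N (?y 0) l = ?r" for l
    using strain[of 0] by (simp add: rho_bar_def rho_bar_F_def)
  have embed: "twice_deriv (\<lambda>t. G (rho_bar \<rho> N (?y t) l)) 0 (deriv G ?r * d l)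
      ((deriv ^^ 2) G ?r * (d l)\<^sup>2 + deriv G ?r * e \<rho> l)" for l
    using twice_deriv_compose[OF _ rho, of G] smooth_on_twice_deriv[OF G, of ?r] r0 by simp
  have "twice_deriv (\<lambda>t. energy_a \<phi> \<rho> G N (?y t)) 0
      (lattice_eps N * (\<Sum>l = - int N + 1..int N. deriv G ?r * d l + 1 / 2 *
          (deriv \<phi> F * w l + deriv \<phi> (2 * F) * (w l + w (l - 1))
           + deriv \<phi> F * w (l + 1) + deriv \<phi> (2 * F) * (w (l + 1) + w (l + 2)))))
      (lattice_eps N * (\<Sum>l = - int N + 1..int N.
          ((deriv ^^ 2) G ?r * (d l)\<^sup>2 + deriv G ?r * e \<rho> l) + 1 / 2 * e \<phi> l))"
    unfolding energy_a_def e_def[of \<phi>]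
    by (intro twice_deriv_cmult twice_deriv_sum twice_deriv_add embed pair \<phi>) simp
  then have var: "second_variation (energy_a \<phi> \<rho> G N) (uniform_deformation F N) u =
      lattice_eps N * (\<Sum>l = - int N + 1..int N.
          ((deriv ^^ 2) G ?r * (d l)\<^sup>2 + deriv G ?r * e \<rho> l) + 1 / 2 * e \<phi> l)"
    unfolding second_variation_def by (rule twice_deriv_imp_deriv2)
  let ?I = "{- int N + 1..int N}"
  have I: "?I = {1 - int N..<1 - int N + int (2 * N)}"
    by auto
  have per: "w (l + int (2 * N)) = w l" for l
    unfolding w_def by (rule bdiff_periodic[OF u])
  have prods: "(\<Sum>l\<in>?I. w (l + i) * w (l + j)) = c (j - i)" for i j
    unfolding I c_def w_def[symmetric] by (rule sum_shifted_products[where w = w, OF per])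
  have c_minus: "c (- j) = c j" for j
    unfolding c_def w_def[symmetric] by (rule autocorrelation_minus[where w = w, OF per])
  let ?a = "deriv \<rho> F" and ?b = "deriv \<rho> (2 * F)"
  \<comment> \<open>The shifts \<open>l + 0\<close> and \<open>l + - 1\<close> are spelled out so
    that every product has the shape rewritten by \<open>prods\<close>.\<close>
  have "(d l)\<^sup>2 = (?a + ?b)\<^sup>2 * (w (l + 0) * w (l + 0)) + (?a + ?b)\<^sup>2 * (w (l + 1) * w (l + 1))
      + 2 * (?a + ?b)\<^sup>2 * (w (l + 0) * w (l + 1))
      + 2 * (?a + ?b) * ?b * (w (l + - 1) * w (l + 0)) + 2 * (?a + ?b) * ?b * (w (l + 0) * w (l + 2))
      + 2 * (?a + ?b) * ?b * (w (l + - 1) * w (l + 1)) + 2 * (?a + ?b) * ?b * (w (l + 1) * w (l + 2))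
      + ?b\<^sup>2 * (w (l + - 1) * w (l + - 1)) + ?b\<^sup>2 * (w (l + 2) * w (l + 2))
      + 2 * ?b\<^sup>2 * (w (l + - 1) * w (l + 2))" for l
    unfolding d_def by (simp add: power2_eq_square algebra_simps)
  then have sum_d: "(\<Sum>l\<in>?I. (d l)\<^sup>2) =
      (?a + ?b)\<^sup>2 * (2 * c 0 + 2 * c 1) + 4 * (?a + ?b) * ?b * (c 1 + c 2)
      + ?b\<^sup>2 * (2 * c 0 + 2 * c 3)"
    by (simp only: sum.distrib sum_distrib_left[symmetric] prods)
       (simp add: algebra_simps)
  have "e f l = (deriv ^^ 2) f F * (w (l + 0) * w (l + 0)) + (deriv ^^ 2) f F * (w (l + 1) * w (l + 1))
      + (deriv ^^ 2) f (2 * F) * (w (l + 0) * w (l + 0))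
      + (deriv ^^ 2) f (2 * F) * (w (l + - 1) * w (l + - 1))
      + 2 * (deriv ^^ 2) f (2 * F) * (w (l + - 1) * w (l + 0))
      + (deriv ^^ 2) f (2 * F) * (w (l + 1) * w (l + 1))
      + (deriv ^^ 2) f (2 * F) * (w (l + 2) * w (l + 2))
      + 2 * (deriv ^^ 2) f (2 * F) * (w (l + 1) * w (l + 2))" for f l
    unfolding e_def by (simp add: power2_eq_square algebra_simps)
  then have sum_e: "(\<Sum>l\<in>?I. e f l) =
      (deriv ^^ 2) f F * (2 * c 0) + (deriv ^^ 2) f (2 * F) * (4 * c 0 + 4 * c 1)" for f
    by (simp only: sum.distrib sum_distrib_left[symmetric] prods)
       (simp add: algebra_simps)
  show ?thesis
    unfolding var sum.distrib sum_distrib_left[symmetric] sum_d sum_e eam_form_def Let_def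
    by (simp add: algebra_simps)
qed

section \<open>Stability\<close>

text \<open>The divided difference is
  \<open>B + C * (t + s) + D * (t\<^sup>2 + t * s + s\<^sup>2)\<close>. On \<open>[0, 4]\<close> the
  part \<open>8 * (t + s)\<close> from \<open>C\<close> dominates the quadratic from
  \<open>D\<close>, and the mixed part of \<open>C\<close> is nonnegative because both density
  slopes are nonpositive.\<close>

lemma lambda_a_mono:
  assumes "deriv \<rho> F \<le> 0" "deriv \<rho> (2 * F) \<le> 0" "(deriv ^^ 2) G (rho_bar_F \<rho> F) \<ge> 0"
    and "coeff_B \<phi> \<rho> G F \<ge> 0" and "0 \<le> s" "s \<le> t" "t \<le> 4"
  shows "lambda_a \<phi> \<rho> G F s \<le> lambda_a \<phi> \<rho> G F t"
proof -
  let ?a = "deriv \<rho> F" and ?b = "deriv \<rho> (2 * F)" and ?g = "(deriv ^^ 2) G (rho_bar_F \<rho> F)"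
  have ab: "0 \<le> 2 * (?a * ?b) * (t + s)"
    using mult_nonpos_nonpos[OF assms(1,2)] assms(5,6) by simp
  \<comment> \<open>The right-hand side is
    \<open>8 * (t + s) - (t\<^sup>2 + t * s + s\<^sup>2)\<close>, split into nonnegative
    pieces.\<close>
  have "0 \<le> t * (4 - t) + s * (4 - s) + 4 * t + s * (4 - t)"
    using assms(5-7) by (intro add_nonneg_nonneg mult_nonneg_nonneg) auto
  then have "0 \<le> coeff_B \<phi> \<rho> G F + ?g * (2 * (?a * ?b) * (t + s)
      + ?b\<^sup>2 * (t * (4 - t) + s * (4 - s) + 4 * t + s * (4 - t)))"
    using assms(3,4) ab by (simp add: mult_nonneg_nonneg add_nonneg_nonneg)
  then have "0 \<le> (t - s) * (coeff_B \<phi> \<rho> G F + ?g * (2 * (?a * ?b) * (t + s)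
      + ?b\<^sup>2 * (t * (4 - t) + s * (4 - s) + 4 * t + s * (4 - t))))"
    using assms(6) by (intro mult_nonneg_nonneg) auto
  also have "\<dots> = lambda_a \<phi> \<rho> G F t - lambda_a \<phi> \<rho> G F s"
    unfolding lambda_a_def coeff_C_def coeff_D_def by algebra
  finally show ?thesis by simp
qed

text \<open>Up to the factor \<open>n\<close>, the form is the spectrum-weighted sum of
  \<open>lambda_a\<close> over the frequencies, and \<open>c 0\<close> is the total weight. With
  frequency 0 empty, every remaining value is at least the one at frequency 1.\<close>

lemma eam_form_ge:
  assumes per: "\<And>l. w (l + int n) = w l" and "n > 0"
    and mean: "(\<Sum>l\<in>{a..<a + int n}. w l) = 0"
    and mono: "\<And>s t. 0 \<le> s \<Longrightarrow> s \<le> t \<Longrightarrow> t \<le> 4 \<Longrightarrow> lambda_a \<phi> \<rho> G F s \<le> lambda_a \<phi> \<rho> G F t"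
  defines "c \<equiv> autocorrelation n a w"
  shows "lambda_a \<phi> \<rho> G F (4 * (sin (pi / n))\<^sup>2) * c 0 \<le> eam_form \<phi> \<rho> G F (c 0) (c 1) (c 2) (c 3)"
proof -
  let ?s1 = "4 * (sin (pi / n))\<^sup>2"
  let ?P = "power_spectrum n a w"
  define x where "x m = cos (2 * pi * real m / real n)" for m
  have wk: "real n * c (int j) = (\<Sum>m<n. ?P m * cos (real j * (2 * pi * real m / real n)))" for j
    using autocorrelation_power_spectrum[where w = w and j = "int j" and a = a, OF per \<open>n > 0\<close>]
    by (simp add: c_def mult_ac)
  \<comment> \<open>The double and triple angle formulas express the moments in \<open>x m\<close>,
    as \<open>eam_form_symbol\<close> requires.\<close>
  have cheb: "real n * c 0 = (\<Sum>m<n. ?P m * 1)" "real n * c 1 = (\<Sum>m<n. ?P m * x m)"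
    "real n * c 2 = (\<Sum>m<n. ?P m * (2 * (x m)\<^sup>2 - 1))"
    "real n * c 3 = (\<Sum>m<n. ?P m * (4 * (x m) ^ 3 - 3 * x m))"
    using wk[of 0] wk[of 1] wk[of 2] wk[of 3]
    by (simp_all only: x_def flip: cos_double_cos cos_treble_cos) simp_all
  have P0: "?P 0 = 0"
    using mean by (simp add: power_spectrum_def)
  have P_nonneg: "?P m \<ge> 0" for m
    by (simp add: power_spectrum_def)
  have low: "lambda_a \<phi> \<rho> G F ?s1 \<le> lambda_a \<phi> \<rho> G F (2 - 2 * x m)" if "m < n" "m \<noteq> 0" for m
  proof -
    have half: "2 - 2 * x m = 4 * (sin (pi * real m / real n))\<^sup>2"
      using cos_double_sin[of "pi * real m / real n"] by (simp add: x_def mult_ac)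
    \<comment> \<open>Frequencies \<open>m\<close> and \<open>n - m\<close> have the same cosine.
      The one with phase in \<open>[0, pi]\<close>, where cosine decreases, has phase at least
      \<open>2 * pi / n\<close>.\<close>
    have "x m \<le> cos (2 * pi / real n)"
    proof (cases "2 * m \<le> n")
      case True
      have "2 * pi / real n \<le> 2 * pi * real m / real n"
        using that by (intro divide_right_mono) auto
      moreover have "2 * pi * real m / real n \<le> pi"
        using True that by (simp add: field_simps flip: of_nat_mult)
      ultimately show ?thesis
        unfolding x_def by (intro cos_monotone_0_pi_le) auto
    next
      case False
      have "x m = cos (2 * pi * real (n - m) / real n)"
      proof -
        have "2 * pi * real (n - m) / real n = 2 * pi - 2 * pi * real m / real n"
          using that by (simp add: of_nat_diff field_simps)
        then show ?thesis by (simp add: x_def cos_diff)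
      qed
      moreover have "2 * pi / real n \<le> 2 * pi * real (n - m) / real n"
        using that by (intro divide_right_mono) auto
      moreover have "2 * pi * real (n - m) / real n \<le> pi"
        using False that by (simp add: of_nat_diff field_simps flip: of_nat_mult)
      ultimately show ?thesis
        by (simp add: cos_monotone_0_pi_le)
    qed
    then have "?s1 \<le> 2 - 2 * x m"
      using cos_double_sin[of "pi / real n"] by (simp add: mult_ac)
    moreover have "2 - 2 * x m \<le> 4"
      using cos_ge_minus_one[of "2 * pi * real m / real n"] unfolding x_def by linarith
    ultimately show ?thesis
      by (intro mono) auto
  qed
  have "real n * (lambda_a \<phi> \<rho> G F ?s1 * c 0) = (\<Sum>m<n. ?P m * lambda_a \<phi> \<rho> G F ?s1)"
    using cheb(1) by (simp add: sum_distrib_right[symmetric] mult_ac)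
  also have "\<dots> \<le> (\<Sum>m<n. ?P m * lambda_a \<phi> \<rho> G F (2 - 2 * x m))"
  proof (rule sum_mono)
    fix m assume "m \<in> {..<n}"
    then show "?P m * lambda_a \<phi> \<rho> G F ?s1 \<le> ?P m * lambda_a \<phi> \<rho> G F (2 - 2 * x m)"
      using low P0 P_nonneg by (cases "m = 0") (auto intro: mult_left_mono)
  qed
  also have "\<dots> = real n * eam_form \<phi> \<rho> G F (c 0) (c 1) (c 2) (c 3)"
    unfolding eam_form_symbol[symmetric] eam_form_mult[symmetric] eam_form_sum cheb ..
  finally show ?thesis
    using \<open>n > 0\<close> by simp
qed

text \<open>The three-term recurrence of \<open>w\<close> passes to its autocorrelation in the lag,
  where it is the Chebyshev recurrence; evenness, \<open>c (- 1) = c 1\<close>, supplies the start.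
  No trigonometric sum has to be evaluated.\<close>

lemma autocorrelation_sinusoid:
  fixes a :: int
  assumes "\<And>l. w (l + int n) = w l" and rec: "\<And>l. w (l + 1) + w (l - 1) = 2 * x * w l"
  defines "c \<equiv> autocorrelation n a w"
  shows "c 1 = c 0 * x" "c 2 = c 0 * (2 * x\<^sup>2 - 1)" "c 3 = c 0 * (4 * x ^ 3 - 3 * x)"
proof -
  have step: "c (j + 1) + c (j - 1) = 2 * x * c j" for j
  proof -
    have "w l * w (l + (j + 1)) + w l * w (l + (j - 1)) = 2 * x * (w l * w (l + j))" for l
      using arg_cong[OF rec[of "l + j"], of "\<lambda>y. w l * y"] by (simp add: algebra_simps)
    then show ?thesis
      by (simp add: c_def autocorrelation_def sum_distrib_left flip: sum.distrib)
  qed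
  have "c (- 1) = c 1"
    unfolding c_def by (rule autocorrelation_minus) fact
  then show c1: "c 1 = c 0 * x"
    using step[of 0] by simp
  show c2: "c 2 = c 0 * (2 * x\<^sup>2 - 1)"
    using step[of 1] c1 by (simp add: power2_eq_square algebra_simps)
  show "c 3 = c 0 * (4 * x ^ 3 - 3 * x)"
    using step[of 2] c1 c2 by (simp add: power2_eq_square power3_eq_cube algebra_simps)
qed

text \<open>At lag 0 the autocorrelation is the sum of squared strains. If all strains vanish,
  \<open>u\<close> is constant, and zero mean makes it zero.\<close>

lemma displacements_strain_nonzero:
  assumes u: "u \<in> displacements N" and "N \<ge> 1" and nz: "u \<noteq> (\<lambda>_. 0)"
  shows "autocorrelation (2 * N) a (bdiff N u) 0 > 0"
proof -
  let ?I = "{a..<a + int (2 * N)}" and ?w = "bdiff N u"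
  have "\<exists>l. ?w l \<noteq> 0"
  proof (rule ccontr)
    assume "\<not> (\<exists>l. ?w l \<noteq> 0)"
    then have step: "u l = u (l - 1)" for l
      using \<open>N \<ge> 1\<close> by (simp add: bdiff_def lattice_eps_def)
    have const: "u l = u 0" for l
    proof (induction l rule: int_induct[where k = 0])
      case (step1 i)
      then show ?case using step[of "i + 1"] by simp
    next
      case (step2 i)
      then show ?case using step[of i] by simp
    qed simp
    have "(\<Sum>l = - int N + 1..int N. u 0) = 0"
      using u const unfolding displacements_def by (metis (mono_tags, lifting) mem_Collect_eq sum.cong)
    then have "u 0 = 0"
      using \<open>N \<ge> 1\<close> by simp
    with const nz show False by auto
  qed
  then obtain i where i: "?w i \<noteq> 0" ..
  have per: "?w (l + int (2 * N)) = ?w l" for l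
    by (rule bdiff_periodic[OF u])
  have "autocorrelation (2 * N) a ?w 0 = (\<Sum>l\<in>?I. (?w l)\<^sup>2)"
    by (simp add: autocorrelation_def power2_eq_square)
  also have "\<dots> = (\<Sum>l\<in>{i..<i + int (2 * N)}. (?w l)\<^sup>2)"
    by (rule sum_period_shift) (simp only: per)
  also have "\<dots> > 0"
    using i \<open>N \<ge> 1\<close> by (intro sum_pos2[of _ i]) auto
  finally show ?thesis .
qed

theorem theorem4p1:
  fixes \<phi> \<rho> G :: "real \<Rightarrow> real" and F :: real and N :: nat
  assumes "smooth_on {0<..} \<phi>" and "smooth_on {0<..} \<rho>" and "smooth_on UNIV G"
    and "F > 0" and "N \<ge> 1"
    and "(deriv ^^ 2) \<phi> F > 0" and "(deriv ^^ 2) \<phi> (2 * F) < 0"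
    and "deriv \<rho> F \<le> 0" and "deriv \<rho> (2 * F) \<le> 0"
    and "(deriv ^^ 2) \<rho> F \<ge> 0" and "(deriv ^^ 2) \<rho> (2 * F) \<ge> 0"
    and "(deriv ^^ 2) G (rho_bar_F \<rho> F) \<ge> 0"
    and "coeff_B \<phi> \<rho> G F \<ge> 0"
  shows "stable_a \<phi> \<rho> G F N \<longleftrightarrow> lambda_a \<phi> \<rho> G F (4 * (sin (pi / (2 * real N)))^2) > 0"
proof
  let ?s1 = "4 * (sin (pi / (2 * real N)))\<^sup>2"
  let ?I = "{1 - int N..<1 - int N + int (2 * N)}"
  have eps: "lattice_eps N > 0"
    using \<open>N \<ge> 1\<close> by (simp add: lattice_eps_def)
  have I: "{- int N + 1..int N} = ?I"
    by auto
  note var = second_variation_energy_a[OF assms(1-5)]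
  {
    assume pos: "lambda_a \<phi> \<rho> G F ?s1 > 0"
    show "stable_a \<phi> \<rho> G F N"
      unfolding stable_a_def
    proof
      fix u assume "u \<in> displacements N - {\<lambda>_. 0}"
      then have u: "u \<in> displacements N" and nz: "u \<noteq> (\<lambda>_. 0)"
        by auto
      let ?c = "autocorrelation (2 * N) (1 - int N) (bdiff N u)"
      \<comment> \<open>By periodicity the strain sums to zero over a period, so its spectrum has no
        mass at frequency 0.\<close>
      have "(\<Sum>l\<in>?I. u (l + - 1)) = sum u ?I"
        by (rule sum_period_translate) (use u in \<open>simp add: displacements_def\<close>)
      then have "(\<Sum>l\<in>?I. bdiff N u l) = 0"
        by (simp add: bdiff_def sum_subtractf flip: sum_divide_distrib)
      then have "lambda_a \<phi> \<rho> G F (4 * (sin (pi / real (2 * N)))\<^sup>2) * ?c 0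
          \<le> eam_form \<phi> \<rho> G F (?c 0) (?c 1) (?c 2) (?c 3)"
        using \<open>N \<ge> 1\<close> assms(8,9,12,13)
        by (intro eam_form_ge bdiff_periodic[OF u] lambda_a_mono) auto
      moreover have "lambda_a \<phi> \<rho> G F ?s1 * ?c 0 > 0"
        using pos displacements_strain_nonzero[OF u \<open>N \<ge> 1\<close> nz] by simp
      ultimately show "second_variation (energy_a \<phi> \<rho> G N) (uniform_deformation F N) u > 0"
        unfolding var[OF u] using eps by simp
    qed
  next
    assume stable: "stable_a \<phi> \<rho> G F N"
    define \<theta> where "\<theta> = pi / real N"
    \<comment> \<open>The lowest nonconstant Fourier mode, whose frequency \<open>m = 1\<close> is
      the one that minimises \<open>lambda_a\<close>.\<close>
    define u where "u l = cos (\<theta> * of_int l)" for l :: int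
    have rec: "u (l + 1) + u (l - 1) = 2 * cos \<theta> * u l" for l
      by (simp add: u_def algebra_simps cos_add cos_diff)
    have per: "u (l + 2 * int N) = u l" for l
    proof -
      have "\<theta> * of_int (l + 2 * int N) = \<theta> * of_int l + 2 * pi"
        using \<open>N \<ge> 1\<close> by (simp add: \<theta>_def field_simps)
      then show ?thesis by (simp add: u_def)
    qed
    \<comment> \<open>Zero mean: summing \<open>rec\<close> over a period multiplies the sum by
      \<open>cos \<theta>\<close>, which is less than 1.\<close>
    have "(\<Sum>l\<in>?I. u (l + 1)) = sum u ?I" "(\<Sum>l\<in>?I. u (l + - 1)) = sum u ?I"
      by (rule sum_period_translate; simp add: per)+
    then have "2 * sum u ?I = (\<Sum>l\<in>?I. u (l + 1) + u (l - 1))"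
      by (simp add: sum.distrib)
    also have "\<dots> = 2 * cos \<theta> * sum u ?I"
      unfolding rec sum_distrib_left ..
    finally have "(1 - cos \<theta>) * sum u ?I = 0"
      by (simp add: algebra_simps)
    moreover have "cos \<theta> < cos 0"
      using \<open>N \<ge> 1\<close> by (intro cos_monotone_0_pi) (auto simp: \<theta>_def field_simps)
    ultimately have u: "u \<in> displacements N"
      using per I by (simp add: displacements_def)
    let ?c = "autocorrelation (2 * N) (1 - int N) (bdiff N u)"
    \<comment> \<open>Differencing is linear and commutes with shifts, so the strain inherits the
      recurrence of \<open>u\<close>.\<close>
    have "bdiff N u (l + 1) + bdiff N u (l - 1) = 2 * cos \<theta> * bdiff N u l" for l
    proof -
      have "bdiff N u (l + 1) + bdiff N u (l - 1) =
          ((u (l + 1) + u (l - 1)) - (u (l - 1 + 1) + u (l - 1 - 1))) / lattice_eps N"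
        by (simp add: bdiff_def add_divide_distrib diff_divide_distrib)
      then show ?thesis
        unfolding rec by (simp add: bdiff_def algebra_simps)
    qed
    note c = autocorrelation_sinusoid[OF bdiff_periodic[OF u] this, of "1 - int N"]
    have "2 - 2 * cos \<theta> = ?s1"
      using cos_double_sin[of "\<theta> / 2"] by (simp add: \<theta>_def mult_ac)
    then have form: "eam_form \<phi> \<rho> G F (?c 0) (?c 1) (?c 2) (?c 3) = ?c 0 * lambda_a \<phi> \<rho> G F ?s1"
      unfolding c using eam_form_mult[of \<phi> \<rho> G F "?c 0" 1] by (simp add: eam_form_symbol)
    have "u 0 \<noteq> 0"
      by (simp add: u_def)
    then have nz: "u \<noteq> (\<lambda>_. 0)"
      by auto
    with stable u have "lattice_eps N * (?c 0 * lambda_a \<phi> \<rho> G F ?s1) > 0"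
      unfolding stable_a_def form[symmetric] var[OF u, symmetric] by blast
    then have "?c 0 * lambda_a \<phi> \<rho> G F ?s1 > 0"
      using eps by (simp only: zero_less_mult_pos)
    then show "lambda_a \<phi> \<rho> G F ?s1 > 0"
      using displacements_strain_nonzero[OF u \<open>N \<ge> 1\<close> nz, of "1 - int N"]
      by (simp add: zero_less_mult_iff)
  }
qed

end
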